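(* Consider the following two multi-round rectangle packing games on $U=[0,1]^2$ between Alice and Bob. In each round $i$, Alice places a point $s_i\in[0,1]^2$ outside of Bob's previously chosen rectangles, and then Bob chooses an axis-aligned rectangle $r_i\subseteq[0,1]^2$ with lower left corner $s_i$, interior-disjoint from his previous rectangles; Alice must place the origin $(0,0)$ in some round. In the $n$-round game the number $n$ of rounds is known to both players in advance; in the unlimited game the number of rounds is not known in advance and the game ends after the round in which Alice places the origin. Bob's greedy strategy is to choose, in each round, a rectangle $r_i$ of maximum area among all admissible rectangles. Then in both versions, the greedy strategy cannot guarantee Bob any positive constant covered area: for every $\varepsilon>0$ Alice can play (in the $n$-round game for a suitable $n$, and in the unlimited game) a finite sequence of points such that the total area of Bob's greedy rectangles is at most $\varepsilon$. *)

theory Defs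
  imports "HOL-Analysis.Analysis"
begin

type_synonym point = "real \<times> real"

definition unit_square :: "point set" where
  "unit_square = cbox (0, 0) (1, 1)"

text \<open>
  The conjunct \<open>s \<in> r\<close> says that the box \<open>cbox s t\<close> is nonempty, so that \<open>s\<close> really is its
  lower left corner. Degenerate boxes are allowed; they are the only choice for a point
  on the upper or right side of the unit square.
\<close>

definition admissible :: "point set set \<Rightarrow> point \<Rightarrow> point set set" where
  "admissible R s =
     {r. (\<exists>t. r = cbox s t) \<and> s \<in> r \<and> r \<subseteq> unit_square \<and>
         (\<forall>q\<in>R. interior q \<inter> interior r = {})}"

definition greedy_choice :: "point set set \<Rightarrow> point \<Rightarrow> point set \<Rightarrow> bool" where
  "greedy_choice R s r \<longleftrightarrow> is_arg_max (measure lborel) (\<lambda>r. r \<in> admissible R s) r"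

text \<open>
  A (deterministic) strategy of Bob maps the nonempty list of all points placed by Alice so
  far, the last one being the current one, to the rectangle with which he answers.
\<close>

type_synonym strategy = "point list \<Rightarrow> point set"

definition reply :: "strategy \<Rightarrow> point list \<Rightarrow> nat \<Rightarrow> point set" where
  "reply \<beta> s i = \<beta> (take (Suc i) s)"

text \<open>Rectangles are closed, so Alice may not place a point on the boundary of one either.\<close>

definition legal :: "strategy \<Rightarrow> point list \<Rightarrow> bool" where
  "legal \<beta> s \<longleftrightarrow>
     (\<forall>i<length s. s ! i \<in> unit_square \<and> (\<forall>j<i. s ! i \<notin> reply \<beta> s j))"

text \<open>How ties between rectangles of maximum area are broken is left to the strategy.\<close>

definition greedy :: "strategy \<Rightarrow> bool" where
  "greedy \<beta> \<longleftrightarrow>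
     (\<forall>s. legal \<beta> s \<longrightarrow>
        (\<forall>i<length s. greedy_choice (reply \<beta> s ` {..<i}) (s ! i) (reply \<beta> s i)))"

definition n_round_play :: "nat \<Rightarrow> strategy \<Rightarrow> point list \<Rightarrow> bool" where
  "n_round_play n \<beta> s \<longleftrightarrow> legal \<beta> s \<and> length s = n \<and> (0, 0) \<in> set s"

definition unlimited_play :: "strategy \<Rightarrow> point list \<Rightarrow> bool" where
  "unlimited_play \<beta> s \<longleftrightarrow>
     legal \<beta> s \<and> s \<noteq> [] \<and> last s = (0, 0) \<and> (0, 0) \<notin> set (butlast s)"

definition covered_area :: "strategy \<Rightarrow> point list \<Rightarrow> real" where
  "covered_area \<beta> s = (\<Sum>i<length s. measure lborel (reply \<beta> s i))"

end

theory Submission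
  imports Defs
begin

text \<open>
  Call a rectangle \<open>[a,b] \<times> [c,1]\<close> swept at rate \<open>\<rho>\<close> if Alice can play in it, ending with its
  corner \<open>(a,c)\<close>, so that Bob covers at most the fraction \<open>\<rho>\<close> of its area and his last reply is a
  strip along the whole left side. One point gives \<open>\<rho> = 1\<close>. To improve a rate, sweep from right
  to left the columns between a staircase below the hyperbola of area \<open>\<alpha> = 2\<^sup>-\<^sup>m\<close> seen from \<open>(a,c)\<close>
  and the top side: the strips left by the sweeps block every rectangle anchored at \<open>(a,c)\<close> along
  the staircase, so the full-height strip of width \<open>\<alpha>(b - a)\<close> is the unique largest one.
  The region under the staircase, whose area is of order \<open>m \<alpha>\<close>, is lost to Bob for a price of
  \<open>\<alpha>\<close>, so the rate changes by \<open>\<rho> \<mapsto> \<rho>(1 - (1 + m/4) \<alpha>) + \<alpha>\<close>, and iterating gets arbitrarily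
  close to \<open>1 / (1 + m/4)\<close>. All inequalities are strict, so Bob's replies are forced and Alice's
  points do not depend on how he breaks ties.
\<close>

section \<open>Areas, interiors and one-point extensions of a play\<close>

lemma measure_cbox_pair:
  fixes a c X Y :: real
  assumes "a \<le> X" "c \<le> Y"
  shows "measure lborel (cbox (a, c) (X, Y)) = (X - a) * (Y - c)"
  using assms by (simp add: content_Pair)

lemma interior_cbox_pair:
  fixes a c X Y :: real
  shows "interior (cbox (a, c) (X, Y)) = {a<..<X} \<times> {c<..<Y}"
  by (simp add: cbox_Pair_eq interior_Times)

lemma reply_append: "i < length ps \<Longrightarrow> reply \<beta> (ps @ qs) i = reply \<beta> ps i"
  by (simp add: reply_def)

lemma covered_area_snoc:
  "covered_area \<beta> (ps @ [p]) = covered_area \<beta> ps + measure lborel (reply \<beta> (ps @ [p]) (length ps))"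
  by (simp add: covered_area_def reply_append lessThan_Suc)

lemma legal_snoc:
  assumes "legal \<beta> ps" "p \<in> unit_square" "\<And>j. j < length ps \<Longrightarrow> p \<notin> reply \<beta> ps j"
  shows "legal \<beta> (ps @ [p])"
  using assms by (auto simp: legal_def nth_append less_Suc_eq reply_append)

section \<open>Walls and forced replies\<close>

definition confined :: "strategy \<Rightarrow> point list \<Rightarrow> real \<Rightarrow> bool" where
  "confined \<beta> ps b \<longleftrightarrow> (\<forall>i<length ps. \<forall>q\<in>reply \<beta> ps i. b \<le> fst q)"

text \<open>The right side of the unit square counts as a wall of any height.\<close>

definition wall :: "strategy \<Rightarrow> point list \<Rightarrow> real \<Rightarrow> real \<Rightarrow> bool" where
  "wall \<beta> ps x y \<longleftrightarrow>
     x = 1 \<or> (\<exists>i<length ps. \<exists>x'>x. reply \<beta> ps i = cbox (x, y) (x', 1))"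

lemma wall_append:
  assumes "wall \<beta> ps x y" shows "wall \<beta> (ps @ qs) x y"
proof (cases "x = 1")
  case False
  then obtain i x' where "i < length ps" "x' > x" "reply \<beta> ps i = cbox (x, y) (x', 1)"
    using assms by (auto simp: wall_def)
  then show ?thesis
    unfolding wall_def by (intro disjI2 exI[of _ i]) (auto simp: reply_append)
qed (simp add: wall_def)

definition disjoint_replies :: "strategy \<Rightarrow> point list \<Rightarrow> point set \<Rightarrow> bool" where
  "disjoint_replies \<beta> ps r \<longleftrightarrow> (\<forall>i<length ps. interior (reply \<beta> ps i) \<inter> interior r = {})"

text \<open>A wall reaches up to the top side, so a rectangle that starts left of it and crosses it
  can only pass underneath. For \<open>x = 1\<close> no rectangle in the unit square
  crosses.\<close>

lemma wall_blocks:
  assumes "wall \<beta> ps x y" "disjoint_replies \<beta> ps (cbox (a, c) (X, Y))"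
    and "a < x" "c < Y" "X \<le> 1" "Y \<le> 1" "x < X"
  shows "Y \<le> y"
proof (rule ccontr)
  assume Y: "\<not> Y \<le> y"
  obtain i x' where i: "i < length ps" "x' > x" "reply \<beta> ps i = cbox (x, y) (x', 1)"
    using assms by (auto simp: wall_def)
  \<comment> \<open>The centre of the overlap of the two open boxes.\<close>
  define p where "p = ((x + min X x') / 2, (max c y + Y) / 2)"
  have "p \<in> interior (reply \<beta> ps i) \<inter> interior (cbox (a, c) (X, Y))"
    unfolding i(3) interior_cbox_pair p_def using assms i(2) Y
    by (auto simp: min_def max_def field_simps)
  then show False
    using assms(2) i(1) by (auto simp: disjoint_replies_def)
qed

text \<open>Confinement makes the strip \<open>cbox (a, c) (x, 1)\<close> admissible. Competitors
  that stop at or before \<open>x\<close> lie inside it, and wider ones are strictly smaller by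
  \<open>small\<close>, so it is the only maximizer and tie-breaking cannot matter.\<close>

lemma forced_reply:
  assumes \<beta>: "greedy \<beta>" and ps: "legal \<beta> ps" "confined \<beta> ps x"
    and bounds: "0 \<le> a" "a < x" "x \<le> 1" "0 \<le> c" "c < 1"
    and small: "\<And>X Y. \<lbrakk>x < X; X \<le> 1; c < Y; Y \<le> 1;
        disjoint_replies \<beta> ps (cbox (a, c) (X, Y))\<rbrakk> \<Longrightarrow> (X - a) * (Y - c) < (x - a) * (1 - c)"
  shows "legal \<beta> (ps @ [(a, c)])"
    and "reply \<beta> (ps @ [(a, c)]) (length ps) = cbox (a, c) (x, 1)"
proof -
  let ?s = "ps @ [(a, c)]"
  show legal: "legal \<beta> ?s"
    using ps bounds by (intro legal_snoc) (force simp: unit_square_def confined_def cbox_Pair_eq)+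
  define r where "r = reply \<beta> ?s (length ps)"
  let ?R = "reply \<beta> ?s ` {..<length ps}"
  let ?T = "cbox (a, c) (x, 1::real)"
  have "greedy_choice ?R (?s ! length ps) r"
    using \<beta> legal unfolding greedy_def r_def by (metis length_append_singleton lessI)
  then have r: "r \<in> admissible ?R (a, c)"
    and max: "\<And>q. q \<in> admissible ?R (a, c) \<Longrightarrow> measure lborel q \<le> measure lborel r"
    by (auto simp: greedy_choice_def is_arg_max_def not_less)
  have "interior q \<inter> interior ?T = {}" if q: "q \<in> ?R" for q
  proof -
    have "\<forall>z\<in>q. x \<le> fst z"
      using q ps(2) by (auto simp: confined_def reply_append)
    then have "\<forall>z\<in>interior q. x \<le> fst z"
      using interior_subset by blast
    then show ?thesis
      unfolding interior_cbox_pair by fastforce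
  qed
  then have "?T \<in> admissible ?R (a, c)"
    using bounds by (auto simp: admissible_def unit_square_def cbox_Pair_eq)
  then have area: "measure lborel ?T \<le> measure lborel r"
    by (rule max)
  obtain X Y where XY: "r = cbox (a, c) (X, Y)"
    using r by (auto simp: admissible_def)
  have le: "a \<le> X" "c \<le> Y" and sub: "cbox (a, c) (X, Y) \<subseteq> unit_square"
    using r by (auto simp: admissible_def XY cbox_Pair_eq)
  have "(X, Y) \<in> unit_square"
    using le by (intro subsetD[OF sub]) (simp add: cbox_Pair_eq)
  then have le1: "X \<le> 1" "Y \<le> 1"
    by (simp_all add: unit_square_def cbox_Pair_eq)
  have area': "(x - a) * (1 - c) \<le> (X - a) * (Y - c)"
    using area bounds le by (simp add: XY measure_cbox_pair)
  \<comment> \<open>Degenerate boxes are admissible but have area \<open>0\<close>; positivity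
    excludes them, which gives the \<open>c < Y\<close> required by \<open>small\<close>.\<close>
  moreover have pos: "(x - a) * (1 - c) > 0"
    using bounds by simp
  ultimately have lt: "c < Y"
    using le by (cases "c = Y") auto
  have "disjoint_replies \<beta> ps (cbox (a, c) (X, Y))"
    using r by (auto simp: admissible_def disjoint_replies_def reply_append XY)
  then have X: "X \<le> x"
    using small[of X Y] area' le1 lt by linarith
  have "(X - a) * (Y - c) \<le> (x - a) * (Y - c)"
    using X lt by (intro mult_right_mono) auto
  then have "(x - a) * (1 - c) \<le> (x - a) * (Y - c)"
    using area' by linarith
  then have Y: "Y = 1"
    using bounds le1 by (auto simp: mult_le_cancel_left)
  then have "X = x"
    using area' bounds X by (auto simp: mult_le_cancel_right)
  then show "reply \<beta> ?s (length ps) = ?T"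
    using XY Y by (simp add: r_def)
qed

lemma forced_strip:
  assumes "greedy \<beta>" "legal \<beta> ps" "confined \<beta> ps x"
    and "0 \<le> a" "a < x" "x \<le> 1" "0 \<le> c" "c < 1"
    and "\<And>X Y. \<lbrakk>x < X; X \<le> 1; c < Y; Y \<le> 1;
        disjoint_replies \<beta> ps (cbox (a, c) (X, Y))\<rbrakk> \<Longrightarrow> (X - a) * (Y - c) < (x - a) * (1 - c)"
  shows "legal \<beta> (ps @ [(a, c)]) \<and> confined \<beta> (ps @ [(a, c)]) a \<and> wall \<beta> (ps @ [(a, c)]) a c \<and>
    covered_area \<beta> (ps @ [(a, c)]) = covered_area \<beta> ps + (x - a) * (1 - c)"
proof (intro conjI)
  note forced = forced_reply[OF assms]
  show "legal \<beta> (ps @ [(a, c)])"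
    by (rule forced(1))
  show "confined \<beta> (ps @ [(a, c)]) a"
    using assms(3,5) forced(2)
    by (fastforce simp: confined_def less_Suc_eq reply_append cbox_Pair_eq)
  show "wall \<beta> (ps @ [(a, c)]) a c"
    using assms(5) forced(2) by (auto simp: wall_def)
  show "covered_area \<beta> (ps @ [(a, c)]) = covered_area \<beta> ps + (x - a) * (1 - c)"
    using assms(5,8) forced(2) by (simp add: covered_area_snoc measure_cbox_pair)
qed

section \<open>Sweepable rates\<close>

text \<open>\<open>qs\<close> is chosen from \<open>a\<close>, \<open>b\<close>, \<open>c\<close>
  alone, before the strategy and the earlier play. A sweep needs a wall at \<open>b\<close> with
  foot no higher than \<open>c\<close> and leaves one at \<open>a\<close> with foot
  \<open>c\<close>, so sweeps can be chained from right to left as long as the bottoms do not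
  descend.\<close>

definition sweepable :: "real \<Rightarrow> bool" where
  "sweepable \<rho> \<longleftrightarrow> (\<forall>a b c. 0 \<le> a \<and> a < b \<and> b \<le> 1 \<and> 0 \<le> c \<and> c < 1 \<longrightarrow>
     (\<exists>qs. qs \<noteq> [] \<and> last qs = (a, c) \<and>
       (\<forall>\<beta> ps c'. greedy \<beta> \<and> legal \<beta> ps \<and> confined \<beta> ps b \<and> wall \<beta> ps b c' \<and> c' \<le> c \<longrightarrow>
          legal \<beta> (ps @ qs) \<and> confined \<beta> (ps @ qs) a \<and> wall \<beta> (ps @ qs) a c \<and>
          covered_area \<beta> (ps @ qs) \<le> covered_area \<beta> ps + \<rho> * ((b - a) * (1 - c)))))"

text \<open>The single point \<open>(a, c)\<close> suffices: a rectangle crossing \<open>b\<close>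
  would have to stay below \<open>c' \<le> c\<close>, which leaves it no height.\<close>

lemma sweepable_one: "sweepable 1"
  unfolding sweepable_def
proof (intro allI impI)
  fix a b c :: real
  assume bounds: "0 \<le> a \<and> a < b \<and> b \<le> 1 \<and> 0 \<le> c \<and> c < 1"
  show "\<exists>qs. qs \<noteq> [] \<and> last qs = (a, c) \<and>
       (\<forall>\<beta> ps c'. greedy \<beta> \<and> legal \<beta> ps \<and> confined \<beta> ps b \<and> wall \<beta> ps b c' \<and> c' \<le> c \<longrightarrow>
          legal \<beta> (ps @ qs) \<and> confined \<beta> (ps @ qs) a \<and> wall \<beta> (ps @ qs) a c \<and>
          covered_area \<beta> (ps @ qs) \<le> covered_area \<beta> ps + 1 * ((b - a) * (1 - c)))"
  proof (intro exI[of _ "[(a, c)]"] conjI allI impI)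
    fix \<beta> ps c'
    assume *: "greedy \<beta> \<and> legal \<beta> ps \<and> confined \<beta> ps b \<and> wall \<beta> ps b c' \<and> c' \<le> c"
    have "legal \<beta> (ps @ [(a, c)]) \<and> confined \<beta> (ps @ [(a, c)]) a \<and> wall \<beta> (ps @ [(a, c)]) a c \<and>
      covered_area \<beta> (ps @ [(a, c)]) = covered_area \<beta> ps + (b - a) * (1 - c)"
    proof (rule forced_strip)
      fix X Y :: real
      assume "b < X" "X \<le> 1" "c < Y" "Y \<le> 1" "disjoint_replies \<beta> ps (cbox (a, c) (X, Y))"
      then have "Y \<le> c'"
        using * bounds wall_blocks[of \<beta> ps b c' a c X Y] by auto
      then show "(X - a) * (Y - c) < (b - a) * (1 - c)"
        using * \<open>c < Y\<close> by linarith
    qed (use * bounds in auto)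
    then show "legal \<beta> (ps @ [(a, c)])" "confined \<beta> (ps @ [(a, c)]) a"
      "wall \<beta> (ps @ [(a, c)]) a c"
      "covered_area \<beta> (ps @ [(a, c)]) \<le> covered_area \<beta> ps + 1 * ((b - a) * (1 - c))"
      by auto
  qed auto
qed

section \<open>Staircases and the improvement of a rate\<close>

text \<open>Columns are swept from the right. Since \<open>y\<close> does not increase to the right,
  the strip left at \<open>x (Suc i)\<close> starts no higher than \<open>y i\<close> and serves as
  the wall for column \<open>i\<close>.\<close>

lemma sweep_columns:
  fixes x y :: "nat \<Rightarrow> real"
  assumes "sweepable \<rho>"
    and x: "\<And>j. j < m \<Longrightarrow> 0 \<le> x j \<and> x j < x (Suc j) \<and> x (Suc j) \<le> 1"
    and y: "\<And>j. j < m \<Longrightarrow> 0 \<le> y j \<and> y j < 1" "\<And>j. y (Suc j) \<le> y j"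
    and "i \<le> m"
  shows "\<exists>qs. \<forall>\<beta> ps c'.
    greedy \<beta> \<and> legal \<beta> ps \<and> confined \<beta> ps (x m) \<and> wall \<beta> ps (x m) c' \<and> (\<forall>j<m. c' \<le> y j) \<longrightarrow>
    legal \<beta> (ps @ qs) \<and> confined \<beta> (ps @ qs) (x i) \<and>
    (\<forall>j\<in>{i..<m}. wall \<beta> (ps @ qs) (x j) (y j)) \<and>
    covered_area \<beta> (ps @ qs)
      \<le> covered_area \<beta> ps + \<rho> * (\<Sum>j=i..<m. (x (Suc j) - x j) * (1 - y j))"
  using \<open>i \<le> m\<close>
proof (induction rule: inc_induct)
  case base
  show ?case by (rule exI[of _ "[]"]) simp
next
  case (step i)
  obtain qs where qs: "\<And>\<beta> ps c'.
    greedy \<beta> \<and> legal \<beta> ps \<and> confined \<beta> ps (x m) \<and> wall \<beta> ps (x m) c' \<and> (\<forall>j<m. c' \<le> y j) \<Longrightarrow>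
    legal \<beta> (ps @ qs) \<and> confined \<beta> (ps @ qs) (x (Suc i)) \<and>
    (\<forall>j\<in>{Suc i..<m}. wall \<beta> (ps @ qs) (x j) (y j)) \<and>
    covered_area \<beta> (ps @ qs)
      \<le> covered_area \<beta> ps + \<rho> * (\<Sum>j=Suc i..<m. (x (Suc j) - x j) * (1 - y j))"
    using step.IH by blast
  obtain qs' where qs': "\<And>\<beta> ps c'.
    greedy \<beta> \<and> legal \<beta> ps \<and> confined \<beta> ps (x (Suc i)) \<and> wall \<beta> ps (x (Suc i)) c' \<and> c' \<le> y i \<Longrightarrow>
    legal \<beta> (ps @ qs') \<and> confined \<beta> (ps @ qs') (x i) \<and> wall \<beta> (ps @ qs') (x i) (y i) \<and>
    covered_area \<beta> (ps @ qs')
      \<le> covered_area \<beta> ps + \<rho> * ((x (Suc i) - x i) * (1 - y i))"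
    using assms(1) x[of i] y(1)[of i] step.hyps unfolding sweepable_def by meson
  show ?case
  proof (intro exI[of _ "qs @ qs'"] allI impI)
    fix \<beta> ps c'
    assume *: "greedy \<beta> \<and> legal \<beta> ps \<and> confined \<beta> ps (x m) \<and> wall \<beta> ps (x m) c' \<and>
      (\<forall>j<m. c' \<le> y j)"
    note 1 = qs[OF *]
    \<comment> \<open>The rightmost column leans on the given wall at \<open>x m\<close>, every
      other column on the strip of its right neighbour.\<close>
    obtain c'' where "wall \<beta> (ps @ qs) (x (Suc i)) c''" "c'' \<le> y i"
    proof (cases "Suc i = m")
      case True
      then show ?thesis
        using * step.hyps wall_append[of \<beta> ps "x m" c' qs] that by blast
    next
      case False
      then show ?thesis
        using 1 step.hyps y(2)[of i] that[of "y (Suc i)"] by simp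
    qed
    then have 2: "legal \<beta> ((ps @ qs) @ qs') \<and> confined \<beta> ((ps @ qs) @ qs') (x i) \<and>
      wall \<beta> ((ps @ qs) @ qs') (x i) (y i) \<and>
      covered_area \<beta> ((ps @ qs) @ qs')
        \<le> covered_area \<beta> (ps @ qs) + \<rho> * ((x (Suc i) - x i) * (1 - y i))"
      using * 1 by (intro qs') auto
    have "wall \<beta> (ps @ qs @ qs') (x j) (y j)" if "j \<in> {i..<m}" for j
    proof (cases "j = i")
      case False
      then have "wall \<beta> (ps @ qs) (x j) (y j)"
        using 1 that by simp
      from wall_append[OF this, of qs'] show ?thesis by simp
    qed (use 2 in simp)
    moreover have "(\<Sum>j=i..<m. (x (Suc j) - x j) * (1 - y j)) =
        (x (Suc i) - x i) * (1 - y i) + (\<Sum>j=Suc i..<m. (x (Suc j) - x j) * (1 - y j))"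
      using step.hyps by (simp add: sum.atLeast_Suc_lessThan)
    ultimately show "legal \<beta> (ps @ qs @ qs') \<and> confined \<beta> (ps @ qs @ qs') (x i) \<and>
      (\<forall>j\<in>{i..<m}. wall \<beta> (ps @ qs @ qs') (x j) (y j)) \<and>
      covered_area \<beta> (ps @ qs @ qs')
        \<le> covered_area \<beta> ps + \<rho> * (\<Sum>j=i..<m. (x (Suc j) - x j) * (1 - y j))"
      using 1 2 by (simp add: distrib_left)
  qed
qed

text \<open>The widths \<open>2 ^ j\<close> add up to \<open>2 ^ m - 1\<close>, and each column
  loses \<open>2 ^ j / 2 ^ (j + 2) = 1 / 4\<close> under the staircase.\<close>

lemma sum_staircase_columns:
  "(\<Sum>j<m. 2 ^ j * (1 - 1 / 2 ^ (j + 2))) = 2 ^ m - (1 + real m / 4)"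
proof (induction m)
  case (Suc m)
  have "(2::real) ^ m * (1 - 1 / 2 ^ (m + 2)) = 2 ^ m - 1 / 4"
    by (simp add: field_simps)
  then show ?case
    unfolding sum.lessThan_Suc Suc by (simp add: field_simps)
qed simp

lemma sweepable_step:
  assumes \<rho>: "sweepable \<rho>" and m: "0 < m"
  shows "sweepable (\<rho> * (1 - (1 + real m / 4) / 2 ^ m) + 1 / 2 ^ m)"
  unfolding sweepable_def
proof (intro allI impI)
  fix a b c :: real
  assume bounds: "0 \<le> a \<and> a < b \<and> b \<le> 1 \<and> 0 \<le> c \<and> c < 1"
  \<comment> \<open>\<open>x j - a\<close> doubles while \<open>y j - c\<close> halves, so all
    corners \<open>(x (Suc j), y j)\<close> span the same area with \<open>(a, c)\<close>. The
    exponent \<open>j + 2\<close> makes it half the area of the strip between \<open>a\<close> and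
    \<open>x 0\<close>; with \<open>j + 1\<close> there would be ties.\<close>
  define x where "x j = a + (b - a) * (2 ^ j / 2 ^ m)" for j
  define y where "y j = c + (1 - c) / 2 ^ (j + 2)" for j
  let ?\<rho>' = "\<rho> * (1 - (1 + real m / 4) / 2 ^ m) + 1 / 2 ^ m"
  have xm: "x m = b"
    by (simp add: x_def)
  have x_mono: "x j < x (Suc j)" for j
    using bounds by (simp add: x_def field_simps)
  have x_le: "x (Suc j) \<le> b" if "j < m" for j
    using lift_Suc_mono_le[of x "Suc j" m] x_mono that by (simp add: less_imp_le xm)
  have a_less: "a < x j" for j
    using bounds by (simp add: x_def)
  have x: "0 \<le> x j \<and> x j < x (Suc j) \<and> x (Suc j) \<le> 1" if "j < m" for j
    using x_mono[of j] x_le[OF that] a_less[of j] bounds by linarith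
  have c_less: "c < y j" for j
    using bounds by (simp add: y_def)
  have "(1 - c) / 2 ^ (j + 2) < 1 - c" for j
  proof -
    have "(1::real) < 2 ^ (j + 2)"
      by (rule one_less_power) auto
    then show ?thesis
      using bounds by (simp add: divide_less_eq)
  qed
  then have y: "0 \<le> y j \<and> y j < 1" for j
    using c_less[of j] bounds unfolding y_def by (smt (verit))
  have y_mono: "y (Suc j) \<le> y j" for j
    using bounds by (simp add: y_def field_simps)
  have corner: "(x (Suc j) - a) * (y j - c) < (x 0 - a) * (1 - c)" for j
  proof -
    have "(x (Suc j) - a) * (y j - c) = (x 0 - a) * (1 - c) / 2"
      by (simp add: x_def y_def field_simps)
    moreover have "(x 0 - a) * (1 - c) > 0"
      using a_less[of 0] bounds by simp
    ultimately show ?thesis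
      by linarith
  qed
  have "(\<Sum>j<m. (x (Suc j) - x j) * (1 - y j))
      = (b - a) * (1 - c) / 2 ^ m * (\<Sum>j<m. 2 ^ j * (1 - 1 / 2 ^ (j + 2)))"
    unfolding sum_distrib_left by (intro sum.cong) (simp_all add: x_def y_def field_simps)
  then have sum: "(\<Sum>j=0..<m. (x (Suc j) - x j) * (1 - y j))
      = (b - a) * (1 - c) / 2 ^ m * (2 ^ m - (1 + real m / 4))"
    unfolding sum_staircase_columns atLeast0LessThan .
  have x0: "x 0 - a = (b - a) / 2 ^ m"
    by (simp add: x_def)
  \<comment> \<open>In units of \<open>(b - a) * (1 - c) / 2 ^ m\<close>, the columns omit the left
    strip, of area \<open>1\<close>, and the region under the staircase, of area
    \<open>real m / 4\<close>. Only the strip is added back, as the last reply.\<close>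
  have area: "\<rho> * (\<Sum>j=0..<m. (x (Suc j) - x j) * (1 - y j)) + (x 0 - a) * (1 - c)
      = ?\<rho>' * ((b - a) * (1 - c))"
    unfolding sum x0 by (simp add: field_simps)
  obtain qs where qs: "\<And>\<beta> ps c'.
    greedy \<beta> \<and> legal \<beta> ps \<and> confined \<beta> ps b \<and> wall \<beta> ps b c' \<and> (\<forall>j<m. c' \<le> y j) \<Longrightarrow>
    legal \<beta> (ps @ qs) \<and> confined \<beta> (ps @ qs) (x 0) \<and>
    (\<forall>j\<in>{0..<m}. wall \<beta> (ps @ qs) (x j) (y j)) \<and>
    covered_area \<beta> (ps @ qs)
      \<le> covered_area \<beta> ps + \<rho> * (\<Sum>j=0..<m. (x (Suc j) - x j) * (1 - y j))"
    using sweep_columns[of \<rho> m x y 0, OF \<rho> x y y_mono le0] unfolding xm by blast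
  show "\<exists>qs. qs \<noteq> [] \<and> last qs = (a, c) \<and>
       (\<forall>\<beta> ps c'. greedy \<beta> \<and> legal \<beta> ps \<and> confined \<beta> ps b \<and> wall \<beta> ps b c' \<and> c' \<le> c \<longrightarrow>
          legal \<beta> (ps @ qs) \<and> confined \<beta> (ps @ qs) a \<and> wall \<beta> (ps @ qs) a c \<and>
          covered_area \<beta> (ps @ qs) \<le> covered_area \<beta> ps + ?\<rho>' * ((b - a) * (1 - c)))"
  proof (intro exI[of _ "qs @ [(a, c)]"] conjI allI impI)
    fix \<beta> ps c'
    assume *: "greedy \<beta> \<and> legal \<beta> ps \<and> confined \<beta> ps b \<and> wall \<beta> ps b c' \<and> c' \<le> c"
    then have "\<forall>j<m. c' \<le> y j"
      using c_less by (meson less_imp_le order_trans)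
    with * have 1: "legal \<beta> (ps @ qs) \<and> confined \<beta> (ps @ qs) (x 0) \<and>
      (\<forall>j\<in>{0..<m}. wall \<beta> (ps @ qs) (x j) (y j)) \<and>
      covered_area \<beta> (ps @ qs)
        \<le> covered_area \<beta> ps + \<rho> * (\<Sum>j=0..<m. (x (Suc j) - x j) * (1 - y j))"
      by (intro qs) auto
    have "legal \<beta> ((ps @ qs) @ [(a, c)]) \<and> confined \<beta> ((ps @ qs) @ [(a, c)]) a \<and>
      wall \<beta> ((ps @ qs) @ [(a, c)]) a c \<and>
      covered_area \<beta> ((ps @ qs) @ [(a, c)]) = covered_area \<beta> (ps @ qs) + (x 0 - a) * (1 - c)"
    proof (rule forced_strip)
      fix X Y :: real
      assume XY: "x 0 < X" "X \<le> 1" "c < Y" "Y \<le> 1"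
        and disj: "disjoint_replies \<beta> (ps @ qs) (cbox (a, c) (X, Y))"
      \<comment> \<open>The wall at \<open>b\<close> is still there, with foot
        \<open>c' \<le> c\<close>, so nothing based at height \<open>c\<close> crosses it.\<close>
      have "X \<le> b"
      proof (rule ccontr)
        assume "\<not> X \<le> b"
        moreover have "wall \<beta> (ps @ qs) b c'"
          using * by (simp add: wall_append)
        ultimately have "Y \<le> c'"
          using wall_blocks[OF _ disj] XY bounds by simp
        then show False
          using * XY by linarith
      qed
      \<comment> \<open>\<open>j\<close> is the column into which \<open>X\<close> falls. The wall
        at its left side caps \<open>Y\<close> at \<open>y j\<close>, so the rectangle fits under
        the corner \<open>(x (Suc j), y j)\<close>.\<close>
      then have "\<exists>j<m. (\<forall>k\<le>j. \<not> X \<le> x k) \<and> X \<le> x (Suc j)"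
        using XY by (intro ex_least_nat_less) (auto simp: xm)
      then obtain j where j: "j < m" "x j < X" "X \<le> x (Suc j)"
        by force
      have "Y \<le> y j"
        using wall_blocks[OF _ disj, of "x j" "y j"] 1 j a_less[of j] XY by simp
      then have "(X - a) * (Y - c) \<le> (x (Suc j) - a) * (y j - c)"
        using j XY a_less[of "Suc j"] by (intro mult_mono) auto
      then show "(X - a) * (Y - c) < (x 0 - a) * (1 - c)"
        using corner[of j] by linarith
    qed (use * 1 bounds a_less[of 0] x[OF m] in auto)
    then show "legal \<beta> (ps @ qs @ [(a, c)])" "confined \<beta> (ps @ qs @ [(a, c)]) a"
      "wall \<beta> (ps @ qs @ [(a, c)]) a c"
      "covered_area \<beta> (ps @ qs @ [(a, c)]) \<le> covered_area \<beta> ps + ?\<rho>' * ((b - a) * (1 - c))"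
      using 1 area by auto
  qed auto
qed

section \<open>Iterating the improvement\<close>

text \<open>Each improvement \<open>\<rho> * q + 1 / 2 ^ m\<close> is an affine contraction with
  fixed point \<open>1 / K\<close>, so the \<open>N\<close>-th iterate from \<open>1\<close> is
  \<open>1 / K + (1 - 1 / K) * q ^ N\<close>. The choice of \<open>m\<close> puts the fixed point
  below \<open>\<epsilon>\<close>.\<close>

lemma sweepable_arbitrarily_small:
  assumes "0 < \<epsilon>"
  shows "\<exists>\<rho>\<le>\<epsilon>. sweepable \<rho>"
proof -
  obtain m :: nat where m: "4 / \<epsilon> < real m"
    using reals_Archimedean2 by blast
  define K where "K = 1 + real m / 4"
  define q where "q = 1 - K / 2 ^ m"
  have "0 < 4 / \<epsilon>"
    using assms by simp
  then have "0 < real m"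
    using m by linarith
  then have m0: "0 < m"
    by simp
  have K: "1 / K < \<epsilon>" "K > 0"
    using m assms by (auto simp: K_def field_simps)
  \<comment> \<open>This bounds \<open>K\<close> by \<open>2 ^ m\<close>, hence
    \<open>0 \<le> q\<close>.\<close>
  have "1 + real m \<le> 2 ^ m"
    by (induction m) auto
  then have q: "0 \<le> q" "q < 1"
    using K by (auto simp: q_def K_def)
  have "sweepable (1 / K + (1 - 1 / K) * q ^ N)" for N
  proof (induction N)
    case 0
    then show ?case using sweepable_one by simp
  next
    case (Suc N)
    have "(1 / K + (1 - 1 / K) * q ^ N) * (1 - K / 2 ^ m) + 1 / 2 ^ m
        = 1 / K + (1 - 1 / K) * q ^ Suc N"
    proof -
      have "1 / K * q + 1 / 2 ^ m = 1 / K"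
        using K by (simp add: q_def field_simps)
      then show ?thesis
        unfolding q_def[symmetric] by (simp add: algebra_simps)
    qed
    then show ?case
      using sweepable_step[OF Suc m0] by (simp add: K_def)
  qed
  moreover have "(\<lambda>N. 1 / K + (1 - 1 / K) * q ^ N) \<longlonglongrightarrow> 1 / K + (1 - 1 / K) * 0"
    using q by (intro tendsto_intros LIMSEQ_power_zero) auto
  then have "eventually (\<lambda>N. 1 / K + (1 - 1 / K) * q ^ N < \<epsilon>) sequentially"
    using K by (intro order_tendstoD(2)) auto
  then obtain N where "1 / K + (1 - 1 / K) * q ^ N < \<epsilon>"
    using eventually_happens trivial_limit_sequentially by blast
  ultimately show ?thesis
    by (meson less_imp_le)
qed

section \<open>The two games\<close>

text \<open>The whole unit square is swept from the empty play, its right side being a wall with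
  foot \<open>0\<close> by convention. The list comes before the strategy, so that one number of
  rounds serves all greedy strategies.\<close>

lemma uniform_play:
  assumes "0 < \<epsilon>"
  shows "\<exists>s. s \<noteq> [] \<and> last s = (0, 0) \<and>
    (\<forall>\<beta>. greedy \<beta> \<longrightarrow> legal \<beta> s \<and> covered_area \<beta> s \<le> \<epsilon>)"
proof -
  obtain \<rho> where \<rho>: "\<rho> \<le> \<epsilon>" "sweepable \<rho>"
    using sweepable_arbitrarily_small[OF assms] by blast
  then obtain s where s: "s \<noteq> []" "last s = (0, 0)" and
    "\<forall>\<beta> ps c'. greedy \<beta> \<and> legal \<beta> ps \<and> confined \<beta> ps 1 \<and> wall \<beta> ps 1 c' \<and> c' \<le> 0 \<longrightarrow>
      legal \<beta> (ps @ s) \<and> confined \<beta> (ps @ s) 0 \<and> wall \<beta> (ps @ s) 0 0 \<and>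
      covered_area \<beta> (ps @ s) \<le> covered_area \<beta> ps + \<rho> * ((1 - 0) * (1 - 0))"
    unfolding sweepable_def by (metis zero_less_one order_refl)
  from this(3)[rule_format, of _ "[]" 0] \<rho>
  have "legal \<beta> s \<and> covered_area \<beta> s \<le> \<epsilon>" if "greedy \<beta>" for \<beta>
    using that by (force simp: legal_def confined_def wall_def covered_area_def)
  with s show ?thesis by blast
qed

text \<open>Each point lies in its own reply, and later points must avoid that reply. This keeps the
  origin out of the earlier rounds of an unlimited game.\<close>

lemma legal_greedy_distinct:
  assumes "greedy \<beta>" "legal \<beta> s"
  shows "distinct s"
proof -
  have "s ! i \<noteq> s ! j" if "i < j" "j < length s" for i j
  proof -
    have "s ! i \<in> reply \<beta> s i"
      using assms that
      by (auto simp: greedy_def greedy_choice_def is_arg_max_def admissible_def)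
    moreover have "s ! j \<notin> reply \<beta> s i"
      using assms(2) that by (auto simp: legal_def)
    ultimately show ?thesis by metis
  qed
  then show ?thesis
    by (metis distinct_conv_nth linorder_neqE_nat)
qed

theorem theorem2:
  "(\<forall>\<epsilon>>0. \<exists>n. \<forall>\<beta>. greedy \<beta> \<longrightarrow>
      (\<exists>s. n_round_play n \<beta> s \<and> covered_area \<beta> s \<le> \<epsilon>)) \<and>
   (\<forall>\<beta>. greedy \<beta> \<longrightarrow>
      (\<forall>\<epsilon>>0. \<exists>s. unlimited_play \<beta> s \<and> covered_area \<beta> s \<le> \<epsilon>))"
proof (intro conjI allI impI)
  fix \<epsilon> :: real
  assume "0 < \<epsilon>"
  then obtain s where s: "s \<noteq> []" "last s = (0, 0)"
    and play: "\<forall>\<beta>. greedy \<beta> \<longrightarrow> legal \<beta> s \<and> covered_area \<beta> s \<le> \<epsilon>"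
    using uniform_play by blast
  have "(0, 0) \<in> set s"
    using s by (metis last_in_set)
  then show "\<exists>n. \<forall>\<beta>. greedy \<beta> \<longrightarrow> (\<exists>s. n_round_play n \<beta> s \<and> covered_area \<beta> s \<le> \<epsilon>)"
    using play by (auto simp: n_round_play_def)
next
  fix \<beta> and \<epsilon> :: real
  assume \<beta>: "greedy \<beta>" and "0 < \<epsilon>"
  then obtain s where s: "s \<noteq> []" "last s = (0, 0)" "legal \<beta> s" "covered_area \<beta> s \<le> \<epsilon>"
    using uniform_play by blast
  have "distinct (butlast s @ [last s])"
    using legal_greedy_distinct[OF \<beta> s(3)] s(1) by simp
  then have "(0, 0) \<notin> set (butlast s)"
    using s(2) by simp
  then show "\<exists>s. unlimited_play \<beta> s \<and> covered_area \<beta> s \<le> \<epsilon>"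
    using s by (auto simp: unlimited_play_def)
qed

end
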